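(* Let $X$ be a normed space over $\mathbb{F}\in\{\mathbb{R},\mathbb{C}\}$ of dimension at least 2, and let $T,S\in\mathbb{B}(X)$. Then $T\parallel_v S$ if and only if there exists $\lambda\in\mathbb{T}$ such that $T\perp_{vB}\big(v(S)T+\lambda v(T)S\big)$.
   Context: $\mathbb{B}(X)$ is the space of bounded linear operators $X\to X$; $S_X$ is the unit sphere of $X$ and $S_{X^*}$ that of its dual $X^*$; $\mathbb{T}=\{\lambda\in\mathbb{F}:|\lambda|=1\}$. For $x\in X$, $J(x)=\{x^*\in S_{X^*}: x^*(x)=\|x\|\}$. The numerical radius of $T\in\mathbb{B}(X)$ is $v(T)=\sup\{|x^*(Tx)|: x\in S_X,\ x^*\in J(x)\}$. $T$ is numerical radius parallel to $S$, written $T\parallel_v S$, if $v(T+\lambda S)=v(T)+v(S)$ for some $\lambda\in\mathbb{T}$. $T$ is numerical radius Birkhoff orthogonal to $S$, written $T\perp_{vB}S$, if $v(T+\alpha S)\ge v(T)$ for all $\alpha\in\mathbb{F}$. *)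

theory Defs
  imports "HOL-Analysis.Analysis"
begin

text \<open>
  The scalar field is the real or the complex field, up to an isometric isomorphism over the reals.
\<close>

class real_or_complex = real_normed_field +
  assumes ex_iso_real_or_complex:
    "\<exists>\<phi> :: 'a \<Rightarrow> complex.
       (\<forall>a b. \<phi> (a + b) = \<phi> a + \<phi> b) \<and>
       (\<forall>a b. \<phi> (a * b) = \<phi> a * \<phi> b) \<and>
       (\<forall>r a. \<phi> (r *\<^sub>R a) = r *\<^sub>R \<phi> a) \<and>
       (\<forall>a. norm (\<phi> a) = norm a) \<and>
       (range \<phi> = \<real> \<or> range \<phi> = UNIV)"

instance real :: real_or_complex
  by standard (rule exI[of _ complex_of_real], simp add: Reals_def scaleR_conv_of_real)

instance complex :: real_or_complex
  by standard (rule exI[of _ "\<lambda>z. z"], simp)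

text \<open>
  A normed space over \<open>'k\<close> is its underlying real normed space together with a compatible scalar
  multiplication by \<open>'k\<close>. For \<open>'k = real\<close>, \<open>smul_of_real\<close> forces \<open>smul = scaleR\<close>.
\<close>

locale normed_space_over =
  vector_space smul for smul :: "'k::real_normed_field \<Rightarrow> 'a::real_normed_vector \<Rightarrow> 'a" +
  assumes norm_smul: "norm (smul c x) = norm c * norm x"
    and smul_of_real: "smul (of_real r) x = r *\<^sub>R x"

text \<open>
  The library function \<open>dim\<close> returns 0 for infinite-dimensional spaces, so the cardinality of a
  basis is used directly.
\<close>

definition dim_at_least ::
    "('k::field \<Rightarrow> 'a::ab_group_add \<Rightarrow> 'a) \<Rightarrow> nat \<Rightarrow> bool" where
  "dim_at_least smul n \<longleftrightarrow>
     (\<exists>B. \<not> module.dependent smul B \<and> module.span smul B = UNIV \<and> (infinite B \<or> n \<le> card B))"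

definition bounded_operators ::
    "('k::real_normed_field \<Rightarrow> 'a::real_normed_vector \<Rightarrow> 'a) \<Rightarrow> ('a \<Rightarrow> 'a) set" where
  "bounded_operators smul =
     {T. Vector_Spaces.linear smul smul T \<and> (\<exists>K. \<forall>x. norm (T x) \<le> K * norm x)}"

definition dual_space ::
    "('k::real_normed_field \<Rightarrow> 'a::real_normed_vector \<Rightarrow> 'a) \<Rightarrow> ('a \<Rightarrow> 'k) set" where
  "dual_space smul =
     {f. Vector_Spaces.linear smul (*) f \<and> (\<exists>K. \<forall>x. norm (f x) \<le> K * norm x)}"

definition support_functionals ::
    "('k::real_normed_field \<Rightarrow> 'a::real_normed_vector \<Rightarrow> 'a) \<Rightarrow> 'a \<Rightarrow> ('a \<Rightarrow> 'k) set" where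
  "support_functionals smul x =
     {f \<in> dual_space smul. onorm f = 1 \<and> f x = of_real (norm x)}"

definition numerical_radius ::
    "('k::real_normed_field \<Rightarrow> 'a::real_normed_vector \<Rightarrow> 'a) \<Rightarrow> ('a \<Rightarrow> 'a) \<Rightarrow> real" where
  "numerical_radius smul T =
     Sup {norm (f (T x)) | x f. norm x = 1 \<and> f \<in> support_functionals smul x}"

definition numerical_radius_parallel ::
    "('k::real_normed_field \<Rightarrow> 'a::real_normed_vector \<Rightarrow> 'a) \<Rightarrow> ('a \<Rightarrow> 'a) \<Rightarrow> ('a \<Rightarrow> 'a) \<Rightarrow> bool" where
  "numerical_radius_parallel smul T S \<longleftrightarrow>
     (\<exists>\<mu>. norm \<mu> = 1 \<and>
        numerical_radius smul (\<lambda>x. T x + smul \<mu> (S x)) =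
          numerical_radius smul T + numerical_radius smul S)"

definition numerical_radius_orthogonal ::
    "('k::real_normed_field \<Rightarrow> 'a::real_normed_vector \<Rightarrow> 'a) \<Rightarrow> ('a \<Rightarrow> 'a) \<Rightarrow> ('a \<Rightarrow> 'a) \<Rightarrow> bool" where
  "numerical_radius_orthogonal smul T S \<longleftrightarrow>
     (\<forall>\<alpha>. numerical_radius smul (\<lambda>x. T x + smul \<alpha> (S x)) \<ge> numerical_radius smul T)"

end

theory Submission
  imports Defs
begin

text \<open>
  Write \<open>a = v(T)\<close> and \<open>b = v(S)\<close>; \<open>v\<close> is a seminorm, its defining set being nonempty by Hahn--Banach.
  If \<open>T\<close> is orthogonal to \<open>b T + \<mu> a S\<close> and \<open>a > 0\<close>, testing with \<open>\<alpha> = - 1 / (a + b)\<close> gives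
  \<open>a \<le> a / (a + b) * v(T - \<mu> S)\<close>, so \<open>v(T - \<mu> S) = a + b\<close>. Conversely, if \<open>v(T + \<mu> S) = a + b\<close>,
  pick \<open>x\<close> and \<open>f \<in> J(x)\<close> with \<open>\<bar>f (T x) + \<mu> f (S x)\<bar>\<close> close to \<open>a + b\<close>. Then \<open>\<bar>f (T x)\<bar>\<close> is close to
  \<open>a\<close>, and by the parallelogram identity in the scalar field \<open>b f (T x) - \<mu> a f (S x)\<close> is close to 0,
  so adding a multiple of \<open>b T - \<mu> a S\<close> to \<open>T\<close> cannot bring the numerical radius below \<open>a\<close>.

  For Hahn--Banach, a minimal sublinear functional is linear, and Zorn's lemma is applied to the
  sublinear functionals below one that is bounded by the norm and already takes the value
  \<open>- norm x\<close> at \<open>- x\<close>.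
\<close>

section \<open>Norming functionals\<close>

text \<open>Only factors \<open>c > 0\<close> are demanded: for an infimum, one inequality then
  yields the other through \<open>inverse c\<close>, and \<open>q 0 = 0\<close> follows by
  doubling.\<close>

definition sublinear :: "('a::real_vector \<Rightarrow> real) \<Rightarrow> bool" where
  "sublinear q \<longleftrightarrow>
     (\<forall>x y. q (x + y) \<le> q x + q y) \<and> (\<forall>c x. 0 < c \<longrightarrow> q (c *\<^sub>R x) = c * q x)"

lemma sublinear_add: "sublinear q \<Longrightarrow> q (x + y) \<le> q x + q y"
  by (simp add: sublinear_def)

lemma sublinear_scale: "sublinear q \<Longrightarrow> 0 < c \<Longrightarrow> q (c *\<^sub>R x) = c * q x"
  by (simp add: sublinear_def)

lemma sublinear_zero: "sublinear q \<Longrightarrow> q 0 = 0"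
  using sublinear_scale[of q 2 0] by simp

lemma sublinear_scale_nonneg: "sublinear q \<Longrightarrow> 0 \<le> c \<Longrightarrow> q (c *\<^sub>R x) = c * q x"
  by (cases "c = 0") (auto simp: sublinear_zero sublinear_scale)

lemma sublinear_minus: "sublinear q \<Longrightarrow> - q (- x) \<le> q x"
  using sublinear_add[of q x "- x"] by (simp add: sublinear_zero)

lemma sublinear_norm: "sublinear norm"
  by (simp add: sublinear_def norm_triangle_ineq)

text \<open>Serves two infima: over a real parameter in \<open>sublinear_below\<close> and over a
  chain in \<open>minimal_sublinear_exists\<close>. An inequality suffices in \<open>scale\<close>
  because it is also applied with \<open>inverse c\<close>.\<close>

lemma sublinear_INF:
  fixes g :: "'i \<Rightarrow> 'a::real_vector \<Rightarrow> real"
  assumes ne: "I \<noteq> {}"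
    and lower: "\<And>x. bdd_below ((\<lambda>i. g i x) ` I)"
    and add: "\<And>i j x y. i \<in> I \<Longrightarrow> j \<in> I \<Longrightarrow> \<exists>k\<in>I. g k (x + y) \<le> g i x + g j y"
    and scale: "\<And>i c x. i \<in> I \<Longrightarrow> 0 < c \<Longrightarrow> \<exists>k\<in>I. g k (c *\<^sub>R x) \<le> c * g i x"
  shows "sublinear (\<lambda>x. INF i\<in>I. g i x)"
proof -
  let ?m = "\<lambda>x. INF i\<in>I. g i x"
  have low: "?m x \<le> g i x" if "i \<in> I" for i x
    using that lower by (rule cINF_lower[rotated])
  have "?m (x + y) \<le> ?m x + ?m y" for x y
  proof -
    \<comment> \<open>The two infima are taken one at a time: over \<open>i\<close> with
      \<open>j\<close> fixed, then over \<open>j\<close>.\<close>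
    have "?m (x + y) - g j y \<le> ?m x" if j: "j \<in> I" for j
    proof (rule cINF_greatest[OF ne])
      fix i assume "i \<in> I"
      with j add obtain k where "k \<in> I" "g k (x + y) \<le> g i x + g j y" by blast
      with low[of k "x + y"] show "?m (x + y) - g j y \<le> g i x" by simp
    qed
    then have "?m (x + y) - ?m x \<le> ?m y"
      by (intro cINF_greatest[OF ne]) (simp add: algebra_simps)
    then show ?thesis by simp
  qed
  moreover have le: "?m (c *\<^sub>R x) \<le> c * ?m x" if "0 < c" for c x
  proof -
    have "?m (c *\<^sub>R x) / c \<le> ?m x"
    proof (rule cINF_greatest[OF ne])
      fix i assume "i \<in> I"
      with that scale obtain k where "k \<in> I" "g k (c *\<^sub>R x) \<le> c * g i x" by blast
      with low[of k "c *\<^sub>R x"] that show "?m (c *\<^sub>R x) / c \<le> g i x"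
        by (simp add: divide_le_eq mult.commute)
    qed
    with that show ?thesis by (simp add: divide_le_eq mult.commute)
  qed
  moreover have "c * ?m x \<le> ?m (c *\<^sub>R x)" if "0 < c" for c x
    using le[of "inverse c" "c *\<^sub>R x"] that by (simp add: field_simps)
  ultimately show ?thesis
    unfolding sublinear_def by (auto intro: antisym)
qed

text \<open>The largest sublinear functional below \<open>q\<close> whose value at \<open>- y\<close> is \<open>- q y\<close>.\<close>

lemma sublinear_below:
  fixes q :: "'a::real_vector \<Rightarrow> real"
  assumes q: "sublinear q"
  obtains r where "sublinear r" "\<And>x. r x \<le> q x" "r (- y) \<le> - q y"
proof
  \<comment> \<open>A sublinear \<open>r\<close> as required satisfies \<open>r x \<le> r (x + t
    *\<^sub>R y) + t * r (- y) \<le> q (x + t *\<^sub>R y) - t * q y\<close> for all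
    \<open>t \<ge> 0\<close>; \<open>?r\<close> is the infimum of these forced upper bounds.\<close>
  let ?g = "\<lambda>t x. q (x + t *\<^sub>R y) - t * q y"
  let ?r = "\<lambda>x. INF t\<in>{0..}. ?g t x"
  have bdd: "bdd_below ((\<lambda>t. ?g t x) ` {0..})" for x
  proof (rule bdd_belowI2)
    fix t :: real assume "t \<in> {0..}"
    \<comment> \<open>Splitting \<open>t *\<^sub>R y\<close> into \<open>x + t *\<^sub>R y\<close>
      and \<open>- x\<close> gives a lower bound independent of \<open>t\<close>.\<close>
    then have "t * q y \<le> q (x + t *\<^sub>R y) + q (- x)"
      using sublinear_add[OF q, of "x + t *\<^sub>R y" "- x"] sublinear_scale_nonneg[OF q, of t y]
      by simp
    then show "- q (- x) \<le> ?g t x" by simp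
  qed
  show "sublinear ?r"
  proof (rule sublinear_INF[OF _ bdd])
    fix s t :: real and x z assume st: "s \<in> {0..}" "t \<in> {0..}"
    have "q ((x + s *\<^sub>R y) + (z + t *\<^sub>R y)) \<le> q (x + s *\<^sub>R y) + q (z + t *\<^sub>R y)"
      by (rule sublinear_add[OF q])
    then have "?g (s + t) (x + z) \<le> ?g s x + ?g t z"
      by (simp add: algebra_simps)
    with st show "\<exists>k\<in>{0..}. ?g k (x + z) \<le> ?g s x + ?g t z"
      by (intro bexI[of _ "s + t"]) auto
  next
    fix t c :: real and x assume "t \<in> {0..}" "0 < c"
    then show "\<exists>k\<in>{0..}. ?g k (c *\<^sub>R x) \<le> c * ?g t x"
      using sublinear_scale[OF q, of c "x + t *\<^sub>R y"]
      by (intro bexI[of _ "c * t"]) (auto simp: algebra_simps)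
  qed simp
  show "?r x \<le> q x" for x
    using cINF_lower[OF bdd, of 0 x] by simp
  show "?r (- y) \<le> - q y"
    using cINF_lower[OF bdd, of 1 "- y"] by (simp add: sublinear_zero[OF q])
qed

lemma minimal_sublinear_exists:
  fixes p :: "'a::real_vector \<Rightarrow> real"
  assumes p: "sublinear p"
  obtains u where "sublinear u" "u \<le> p" "\<And>q. sublinear q \<Longrightarrow> q \<le> u \<Longrightarrow> q = u"
proof -
  define A where "A = {q. sublinear q \<and> q \<le> p}"
  \<comment> \<open>Zorn's lemma yields maximal elements, so the pointwise order is
    reversed.\<close>
  define P where "P = (\<lambda>q r :: 'a \<Rightarrow> real. r \<le> q)"
  have "\<exists>m\<in>A. \<forall>a\<in>A. P m a \<longrightarrow> a = m"
  proof (rule predicate_Zorn)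
    show "partial_order_on A (relation_of P A)"
      by (rule partial_order_on_relation_ofI) (auto simp: P_def)
  next
    fix C assume "C \<in> Chains (relation_of P A)"
    then have CA: "C \<subseteq> A" and chain: "\<And>q r. q \<in> C \<Longrightarrow> r \<in> C \<Longrightarrow> q \<le> r \<or> r \<le> q"
      by (auto simp: Chains_def relation_of_def P_def)
    show "\<exists>u\<in>A. \<forall>a\<in>C. P a u"
    proof (cases "C = {}")
      case True
      with p show ?thesis by (auto simp: A_def)
    next
      case False
      have sub: "sublinear q" and le: "q x \<le> p x" if "q \<in> C" for q x
        using CA that by (auto simp: A_def le_fun_def)
      let ?m = "\<lambda>x. INF q\<in>C. q x"
      have bdd: "bdd_below ((\<lambda>q. q x) ` C)" for x
      proof (rule bdd_belowI2)
        \<comment> \<open>The bound is common to the whole chain: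
          \<open>- p (- x) \<le> - q (- x) \<le> q x\<close>.\<close>
        fix q assume "q \<in> C"
        then show "- p (- x) \<le> q x"
          using sublinear_minus[OF sub, of q x] le[of q "- x"] by simp
      qed
      have "sublinear ?m"
      proof (rule sublinear_INF[OF False bdd])
        fix q r :: "'a \<Rightarrow> real" and x y assume qr: "q \<in> C" "r \<in> C"
        \<comment> \<open>The witness is the smaller of \<open>q\<close> and
          \<open>r\<close>.\<close>
        show "\<exists>k\<in>C. k (x + y) \<le> q x + r y"
          using chain[OF qr]
        proof
          assume "q \<le> r"
          then have "q y \<le> r y" by (simp add: le_fun_def)
          with qr sublinear_add[OF sub, of q x y] show ?thesis by (intro bexI[of _ q]) auto
        next
          assume "r \<le> q"
          then have "r x \<le> q x" by (simp add: le_fun_def)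
          with qr sublinear_add[OF sub, of r x y] show ?thesis by (intro bexI[of _ r]) auto
        qed
      qed (use sublinear_scale[OF sub] in force)
      moreover have m: "?m x \<le> q x" if "q \<in> C" for q x
        using bdd that by (rule cINF_lower)
      moreover obtain q where "q \<in> C" using False by blast
      then have "?m x \<le> p x" for x
        using m le by (meson order.trans)
      ultimately show ?thesis
        by (intro bexI[of _ ?m]) (auto simp: A_def P_def le_fun_def)
    qed
  qed
  then obtain u where "sublinear u" "u \<le> p"
    and max: "\<And>q. sublinear q \<Longrightarrow> q \<le> p \<Longrightarrow> q \<le> u \<Longrightarrow> q = u"
    unfolding A_def P_def by blast
  \<comment> \<open>From \<open>q \<le> u \<le> p\<close> every competitor lies in \<open>A\<close>,
    so \<open>u\<close> is minimal among all sublinear functionals.\<close>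
  then show ?thesis
    using that by (meson order.trans)
qed

text \<open>Minimality forces the functional from \<open>sublinear_below\<close> to equal
  \<open>u\<close>, which gives \<open>u (- x) \<le> - u x\<close>; the reverse is
  \<open>sublinear_minus\<close>.\<close>

lemma minimal_sublinear_minus:
  fixes u :: "'a::real_vector \<Rightarrow> real"
  assumes u: "sublinear u" and min: "\<And>q. sublinear q \<Longrightarrow> q \<le> u \<Longrightarrow> q = u"
  shows "u (- x) = - u x"
proof -
  obtain r where "sublinear r" "\<And>x. r x \<le> u x" and r: "r (- x) \<le> - u x"
    using sublinear_below[OF u] by blast
  then have "r = u" by (intro min) (auto simp: le_fun_def)
  with r sublinear_minus[OF u, of x] show ?thesis by simp
qed

text \<open>Oddness turns subadditivity at \<open>- x\<close> and \<open>- y\<close> into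
  superadditivity, and carries homogeneity over to negative factors.\<close>

lemma minimal_sublinear_linear:
  fixes u :: "'a::real_vector \<Rightarrow> real"
  assumes u: "sublinear u" and min: "\<And>q. sublinear q \<Longrightarrow> q \<le> u \<Longrightarrow> q = u"
  shows "linear u"
proof
  note minus = minimal_sublinear_minus[OF u min]
  show "u (x + y) = u x + u y" for x y
    using sublinear_add[OF u, of x y] sublinear_add[OF u, of "- x" "- y"] minus[of "x + y"]
    by (simp add: minus)
  show "u (c *\<^sub>R x) = c *\<^sub>R u x" for c x
    using sublinear_scale_nonneg[OF u, of c x] sublinear_scale_nonneg[OF u, of "- c" x]
    by (cases "0 \<le> c") (auto simp: minus)
qed

text \<open>A minimal functional below the bare norm, such as 0, need not norm \<open>x\<close>.
  Starting below \<open>p\<close> forces \<open>- u x = u (- x) \<le> - norm x\<close>.\<close>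

theorem real_norming_functional:
  fixes x :: "'a::real_normed_vector"
  obtains u where "linear u" "\<And>y. u y \<le> norm y" "u x = norm x"
proof -
  obtain p where p: "sublinear p" "\<And>y. p y \<le> norm y" "p (- x) \<le> - norm x"
    using sublinear_below[OF sublinear_norm] by blast
  obtain u where u: "sublinear u" "u \<le> p" and min: "\<And>q. sublinear q \<Longrightarrow> q \<le> u \<Longrightarrow> q = u"
    using minimal_sublinear_exists[OF p(1)] by blast
  have up: "u y \<le> p y" for y using u(2) by (simp add: le_fun_def)
  have le: "u y \<le> norm y" for y using up[of y] p(2)[of y] by simp
  show thesis
  proof
    show "linear u" by (rule minimal_sublinear_linear[OF u(1) min])
    show "u y \<le> norm y" for y by (rule le)
    show "u x = norm x"
      using le[of x] up[of "- x"] p(3) minimal_sublinear_minus[OF u(1) min, of x] by simp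
  qed
qed

section \<open>Support functionals\<close>

context normed_space_over
begin

lemma functional_iff:
  "Vector_Spaces.linear smul (*) f \<longleftrightarrow>
     (\<forall>x y. f (x + y) = f x + f y) \<and> (\<forall>c x. f (smul c x) = c * f x)"
proof -
  have "module ((*) :: 'k \<Rightarrow> 'k \<Rightarrow> 'k)"
    by unfold_locales (simp_all add: algebra_simps)
  then show ?thesis
    by (simp add: linear_iff_module_hom module_hom_iff module_axioms)
qed

lemma operator_iff:
  "Vector_Spaces.linear smul smul U \<longleftrightarrow>
     (\<forall>x y. U (x + y) = U x + U y) \<and> (\<forall>c x. U (smul c x) = smul c (U x))"
  by (simp add: linear_iff_module_hom module_hom_iff module_axioms)

text \<open>The facts on \<open>onorm\<close> concern real bounded linear maps;
  \<open>smul_of_real\<close> supplies the real homogeneity.\<close>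

lemma functional_bounded_linear:
  assumes f: "Vector_Spaces.linear smul (*) f" and K: "\<And>x. norm (f x) \<le> K * norm x"
  shows "bounded_linear f"
proof
  show "f (x + y) = f x + f y" for x y
    using f by (simp add: functional_iff)
  show "f (r *\<^sub>R x) = r *\<^sub>R f x" for r x
    using f smul_of_real[of r x] by (metis functional_iff scaleR_conv_of_real)
  show "\<exists>K. \<forall>x. norm (f x) \<le> norm x * K"
    using K by (auto simp: mult.commute)
qed

lemma support_functional_add: "f \<in> support_functionals smul x \<Longrightarrow> f (y + z) = f y + f z"
  and support_functional_smul: "f \<in> support_functionals smul x \<Longrightarrow> f (smul c y) = c * f y"
  by (simp_all add: support_functionals_def dual_space_def functional_iff)

lemma support_functional_bound:
  assumes "f \<in> support_functionals smul x"
  shows "norm (f y) \<le> norm y"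
proof -
  have "bounded_linear f" "onorm f = 1"
    using assms functional_bounded_linear
    by (auto simp: support_functionals_def dual_space_def)
  then show ?thesis
    using onorm[of f y] by simp
qed

text \<open>The bound gives \<open>onorm f \<le> 1\<close>; the quotient
  \<open>norm (f x) / norm x = 1\<close> at \<open>x \<noteq> 0\<close> gives the reverse.\<close>

lemma support_functionalI:
  assumes f: "Vector_Spaces.linear smul (*) f" and le: "\<And>y. norm (f y) \<le> norm y"
    and x: "f x = of_real (norm x)" "x \<noteq> 0"
  shows "f \<in> support_functionals smul x"
proof -
  have "bounded_linear f"
    using functional_bounded_linear[OF f, of 1] le by simp
  then have "norm (f x) / norm x \<le> onorm f"
    by (rule le_onorm)
  with x have "1 \<le> onorm f" by simp
  moreover have "onorm f \<le> 1"
    using onorm_bound[of 1 f] le by simp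
  moreover have "\<exists>K. \<forall>y. norm (f y) \<le> K * norm y"
    using le by (intro exI[of _ 1]) simp
  ultimately show ?thesis
    using f x by (simp add: support_functionals_def dual_space_def)
qed

end

text \<open>A nonzero vector makes the set defining \<open>numerical_radius\<close> nonempty, so
  that \<open>Sup\<close> can be bounded from above.\<close>

locale nontrivial_normed_space = normed_space_over smul
  for smul :: "'k::real_or_complex \<Rightarrow> 'a::real_normed_vector \<Rightarrow> 'a" +
  assumes nontrivial: "\<exists>x :: 'a. x \<noteq> 0"
begin

text \<open>A real norming functional is already scalar-linear when all scalars are real; otherwise
  it is complexified, and its norm is controlled by rotating the argument.\<close>

lemma support_functional_exists:
  assumes x: "x \<noteq> 0"
  shows "\<exists>f. f \<in> support_functionals smul x"
proof -
  obtain u where u: "linear u" "\<And>y. u y \<le> norm y" "u x = norm x"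
    using real_norming_functional[of x] by blast
  have u_add: "u (y + z) = u y + u z" for y z
    by (rule linear_add[OF u(1)])
  have u_real: "u (smul (of_real r) y) = r * u y" for r y
    using linear_scale[OF u(1)] by (simp add: smul_of_real)
  have u_abs: "\<bar>u y\<bar> \<le> norm y" for y
    using u(2)[of y] u(2)[of "- y"] linear_neg[OF u(1), of y] by simp
  obtain \<phi> :: "'k \<Rightarrow> complex"
    where add: "\<And>a b. \<phi> (a + b) = \<phi> a + \<phi> b" and mult: "\<And>a b. \<phi> (a * b) = \<phi> a * \<phi> b"
      and scale: "\<And>r a. \<phi> (r *\<^sub>R a) = r *\<^sub>R \<phi> a" and norm: "\<And>a. norm (\<phi> a) = norm a"
      and range: "range \<phi> = \<real> \<or> range \<phi> = UNIV"
    using ex_iso_real_or_complex by blast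
  have "linear \<phi>"
    using add scale by (rule linearI)
  then have inj: "a = b" if "\<phi> a = \<phi> b" for a b
    using that norm[of "a - b"] by (simp add: linear_diff)
  \<comment> \<open>A nonzero idempotent complex number is 1; hence \<open>\<phi>\<close> sends real
    scalars to the same real numbers.\<close>
  have "\<phi> 1 * \<phi> 1 = \<phi> 1" "\<phi> 1 \<noteq> 0"
    using mult[of 1 1] norm[of 1] by auto
  then have "\<phi> 1 = 1" by simp
  then have of_real: "\<phi> (of_real r) = of_real r" for r
    using scale[of r 1] by (simp add: of_real_def)
  show ?thesis
    using range
  proof
    assume R: "range \<phi> = \<real>"
    have k: "\<exists>r. c = of_real r" for c :: 'k
    proof -
      have "\<phi> c \<in> \<real>" using R by blast
      then obtain r where "\<phi> c = of_real r" by (auto elim: Reals_cases)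
      then show ?thesis using inj[of c "of_real r"] of_real by auto
    qed
    let ?f = "\<lambda>y. of_real (u y) :: 'k"
    have smul: "?f (smul c y) = c * ?f y" for c y
      using k[of c] by (auto simp: u_real)
    have "?f \<in> support_functionals smul x"
      by (rule support_functionalI) (use x u smul u_abs in \<open>auto simp: functional_iff u_add\<close>)
    then show ?thesis by blast
  next
    assume "range \<phi> = UNIV"
    then obtain j where j: "\<phi> j = \<i>" by (metis UNIV_I imageE)
    have jj: "j * j = - 1"
      by (rule inj) (use \<open>linear \<phi>\<close> \<open>\<phi> 1 = 1\<close> in \<open>simp add: mult j linear_neg\<close>)
    have k: "c = of_real (Re (\<phi> c)) + of_real (Im (\<phi> c)) * j" for c
      by (rule inj) (simp add: add mult of_real j complex_eq mult.commute)
    \<comment> \<open>The usual complexification: the scalar-linear functional whose real part is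
      \<open>u\<close>, with \<open>j\<close> as imaginary unit.\<close>
    let ?f = "\<lambda>y. of_real (u y) - j * of_real (u (smul j y))"
    have f_add: "?f (y + z) = ?f y + ?f z" for y z
      by (simp add: u_add scale_right_distrib algebra_simps)
    have f_real: "?f (smul (of_real r) y) = of_real r * ?f y" for r y
    proof -
      have "smul j (smul (of_real r) y) = smul (of_real r) (smul j y)"
        by (simp add: mult.commute)
      then show ?thesis
        by (simp only: u_real) (simp add: algebra_simps)
    qed
    have f_j: "?f (smul j y) = j * ?f y" for y
    proof -
      have "smul j (smul j y) = - y"
        using scale_scale[of j j y] by (simp add: jj)
      then show ?thesis
        by (simp add: linear_neg[OF u(1)] right_diff_distrib jj flip: mult.assoc)
    qed
    have f_smul: "?f (smul c y) = c * ?f y" for c y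
    proof -
      define r s where "r = Re (\<phi> c)" and "s = Im (\<phi> c)"
      have c: "c = of_real r + of_real s * j"
        using k[of c] by (simp add: r_def s_def)
      have "smul c y = smul (of_real r) y + smul (of_real s) (smul j y)"
        unfolding c by (simp add: scale_left_distrib)
      then show ?thesis
        by (simp only: f_add f_real f_j) (simp add: c algebra_simps)
    qed
    have phi_f: "\<phi> (?f y) = Complex (u y) (- u (smul j y))" for y
      using \<open>linear \<phi>\<close> by (simp add: linear_diff mult of_real j complex_eq_iff)
    have f_le: "norm (?f y) \<le> norm y" for y
    proof (cases "?f y = 0")
      case False
      \<comment> \<open>The unimodular \<open>c\<close> rotates the value of \<open>?f\<close> to a
        nonnegative real, where \<open>?f\<close> agrees with \<open>u\<close> and the bound on
        \<open>u\<close> applies.\<close>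
      define c where "c = of_real (norm (?f y)) / ?f y"
      have c: "norm c = 1" "c * ?f y = of_real (norm (?f y))"
        using False by (simp_all add: c_def norm_divide)
      have "Complex (u (smul c y)) (- u (smul j (smul c y))) = of_real (norm (?f y))"
        using phi_f[of "smul c y"] by (simp only: f_smul c of_real)
      then have "u (smul c y) = norm (?f y)"
        by (metis Re_complex_of_real complex.sel(1))
      then show ?thesis
        using u(2)[of "smul c y"] by (simp add: norm_smul c)
    qed simp
    \<comment> \<open>The real part at \<open>x\<close> already exhausts the bound
      \<open>norm x\<close>, so the imaginary part vanishes.\<close>
    have "cmod (Complex (u x) (- u (smul j x))) \<le> norm x"
      using f_le[of x] by (simp only: flip: phi_f norm)
    then have "(norm x)\<^sup>2 + (u (smul j x))\<^sup>2 \<le> (norm x)\<^sup>2"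
      by (intro sqrt_le_D) (simp add: complex_norm u(3))
    then have "u (smul j x) = 0" by simp
    then have "?f x = of_real (norm x)" by (simp add: u(3))
    then have "?f \<in> support_functionals smul x"
      by (intro support_functionalI) (use x f_le f_add f_smul in \<open>auto simp only: functional_iff\<close>)
    then show ?thesis by blast
  qed
qed

section \<open>The numerical radius\<close>

lemma bounded_operators_add:
  assumes "U \<in> bounded_operators smul" "V \<in> bounded_operators smul"
  shows "(\<lambda>x. U x + V x) \<in> bounded_operators smul"
proof -
  obtain K L where "\<And>x. norm (U x) \<le> K * norm x" "\<And>x. norm (V x) \<le> L * norm x"
    using assms by (auto simp: bounded_operators_def)
  then have "norm (U x + V x) \<le> (K + L) * norm x" for x
    unfolding distrib_right by (rule order.trans[OF norm_triangle_ineq add_mono])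
  then have "\<exists>K. \<forall>x. norm (U x + V x) \<le> K * norm x" by blast
  with assms show ?thesis
    by (auto simp: bounded_operators_def operator_iff scale_right_distrib)
qed

lemma bounded_operators_smul:
  assumes "U \<in> bounded_operators smul"
  shows "(\<lambda>x. smul c (U x)) \<in> bounded_operators smul"
proof -
  obtain K where "\<And>x. norm (U x) \<le> K * norm x"
    using assms by (auto simp: bounded_operators_def)
  then have "norm (smul c (U x)) \<le> (norm c * K) * norm x" for x
    by (simp add: norm_smul mult_left_mono mult.assoc)
  then have "\<exists>K. \<forall>x. norm (smul c (U x)) \<le> K * norm x" by blast
  with assms show ?thesis
    by (auto simp: bounded_operators_def operator_iff scale_right_distrib mult.commute)
qed

text \<open>Support functionals do not increase norms, so an operator bound of \<open>U\<close>
  bounds the set under \<open>Sup\<close>.\<close>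

lemma numerical_radius_upper:
  assumes U: "U \<in> bounded_operators smul" and x: "norm x = 1" "f \<in> support_functionals smul x"
  shows "norm (f (U x)) \<le> numerical_radius smul U"
proof -
  obtain K where K: "\<And>x. norm (U x) \<le> K * norm x"
    using U by (auto simp: bounded_operators_def)
  have "norm (g (U y)) \<le> K" if "norm y = 1" "g \<in> support_functionals smul y" for y g
    using support_functional_bound[OF that(2), of "U y"] K[of y] that(1) by simp
  then have "bdd_above {norm (g (U y)) | y g. norm y = 1 \<and> g \<in> support_functionals smul y}"
    by (intro bdd_aboveI[of _ K]) auto
  then show ?thesis
    unfolding numerical_radius_def using x by (intro cSup_upper) auto
qed

lemma unit_support_exists: "\<exists>x f. norm x = 1 \<and> f \<in> support_functionals smul x"
proof -
  obtain y :: 'a where "y \<noteq> 0" using nontrivial by blast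
  then have "norm (y /\<^sub>R norm y) = 1" by simp
  moreover then have "y /\<^sub>R norm y \<noteq> 0" by (metis norm_zero zero_neq_one)
  ultimately show ?thesis
    using support_functional_exists by blast
qed

lemma numerical_radius_least:
  assumes "\<And>x f. norm x = 1 \<Longrightarrow> f \<in> support_functionals smul x \<Longrightarrow> norm (f (U x)) \<le> M"
  shows "numerical_radius smul U \<le> M"
  unfolding numerical_radius_def
proof (rule cSup_least)
  show "{norm (f (U x)) | x f. norm x = 1 \<and> f \<in> support_functionals smul x} \<noteq> {}"
    using unit_support_exists by blast
qed (use assms in blast)

lemma numerical_radius_nonneg:
  assumes "U \<in> bounded_operators smul"
  shows "0 \<le> numerical_radius smul U"
proof -
  obtain x f where "norm x = 1" "f \<in> support_functionals smul x"
    using unit_support_exists by blast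
  then show ?thesis
    by (rule order.trans[OF norm_ge_zero numerical_radius_upper[OF assms]])
qed

lemma numerical_radius_triangle:
  assumes "U \<in> bounded_operators smul" "V \<in> bounded_operators smul"
  shows "numerical_radius smul (\<lambda>x. U x + V x) \<le> numerical_radius smul U + numerical_radius smul V"
proof (rule numerical_radius_least)
  fix x f assume x: "norm x = 1" "f \<in> support_functionals smul x"
  show "norm (f (U x + V x)) \<le> numerical_radius smul U + numerical_radius smul V"
    unfolding support_functional_add[OF x(2)]
    by (rule order.trans[OF norm_triangle_ineq add_mono]) (rule numerical_radius_upper assms x)+
qed

lemma numerical_radius_smul_le:
  assumes "U \<in> bounded_operators smul"
  shows "numerical_radius smul (\<lambda>x. smul c (U x)) \<le> norm c * numerical_radius smul U"
proof (rule numerical_radius_least)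
  fix x f assume x: "norm x = 1" "f \<in> support_functionals smul x"
  show "norm (f (smul c (U x))) \<le> norm c * numerical_radius smul U"
    using numerical_radius_upper[OF assms x]
    by (simp add: support_functional_smul[OF x(2)] norm_mult mult_left_mono)
qed

lemma numerical_radius_smul:
  assumes U: "U \<in> bounded_operators smul"
  shows "numerical_radius smul (\<lambda>x. smul c (U x)) = norm c * numerical_radius smul U"
proof (cases "c = 0")
  case True
  then show ?thesis
    using numerical_radius_smul_le[OF U, of 0]
      numerical_radius_nonneg[OF bounded_operators_smul[OF U, of 0]] by simp
next
  case False
  \<comment> \<open>The reverse inequality is the same bound for \<open>inverse c\<close>, applied
    to the scaled operator.\<close>
  then have "numerical_radius smul U \<le> norm (inverse c) * numerical_radius smul (\<lambda>x. smul c (U x))"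
    using numerical_radius_smul_le[OF bounded_operators_smul[OF U, of c], of "inverse c"] by simp
  with False have "norm c * numerical_radius smul U \<le> numerical_radius smul (\<lambda>x. smul c (U x))"
    by (simp add: norm_inverse) (simp add: field_simps)
  with numerical_radius_smul_le[OF U, of c] show ?thesis by simp
qed

end

section \<open>Near equality in the triangle inequality for scalars\<close>

text \<open>If the sum almost reaches \<open>a + b\<close>, then \<open>z\<close> and
  \<open>w\<close> are almost in the proportion \<open>a\<close> to \<open>b\<close>; the identity
  below measures the deviation.\<close>

lemma norm_cross_difference_le:
  fixes z w :: "'k::real_or_complex"
  assumes z: "norm z \<le> a" and w: "norm w \<le> b" and e: "a + b - e \<le> norm (z + w)"
  shows "(norm (of_real b * z - of_real a * w))\<^sup>2 \<le> 2 * a * b * (a + b) * e"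
proof -
  have ab: "0 \<le> a" "0 \<le> b"
    using z w norm_ge_zero order.trans by blast+
  \<comment> \<open>A weighted parallelogram law, the usual one for \<open>a = b = 1\<close>: the
    cross terms of the two squares cancel.\<close>
  have identity: "(norm (of_real b * z - of_real a * w))\<^sup>2 =
      b * (a + b) * (norm z)\<^sup>2 + a * (a + b) * (norm w)\<^sup>2 - a * b * (norm (z + w))\<^sup>2"
  proof -
    obtain \<phi> :: "'k \<Rightarrow> complex"
      where add: "\<And>a b. \<phi> (a + b) = \<phi> a + \<phi> b"
        and scale: "\<And>r a. \<phi> (r *\<^sub>R a) = r *\<^sub>R \<phi> a" and norm: "\<And>a. norm (\<phi> a) = norm a"
      using ex_iso_real_or_complex by blast
    have "linear \<phi>"
      using add scale by (rule linearI)
    then have "\<phi> (of_real b * z - of_real a * w) = b *\<^sub>R \<phi> z - a *\<^sub>R \<phi> w"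
      by (simp add: linear_diff scale flip: scaleR_conv_of_real)
    then show ?thesis
      unfolding norm[symmetric] add cmod_power2
      by (simp add: cmod_power2) (simp add: power2_eq_square algebra_simps)
  qed
  have "(norm z)\<^sup>2 \<le> a\<^sup>2" "(norm w)\<^sup>2 \<le> b\<^sup>2"
    using z w by (auto intro: power_mono)
  then have "b * (a + b) * (norm z)\<^sup>2 + a * (a + b) * (norm w)\<^sup>2 \<le> b * (a + b) * a\<^sup>2 + a * (a + b) * b\<^sup>2"
    using ab by (intro add_mono mult_left_mono) auto
  also have "\<dots> = a * b * (a + b)\<^sup>2"
    by (simp add: power2_eq_square algebra_simps)
  finally have "(norm (of_real b * z - of_real a * w))\<^sup>2 \<le> a * b * ((a + b)\<^sup>2 - (norm (z + w))\<^sup>2)"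
    unfolding identity by (simp add: right_diff_distrib)
  also have "(a + b)\<^sup>2 - (norm (z + w))\<^sup>2 \<le> 2 * (a + b) * e"
  proof -
    let ?s = "norm (z + w)"
    have s: "?s \<le> a + b"
      using norm_triangle_ineq[of z w] z w by simp
    have "(a + b)\<^sup>2 - ?s\<^sup>2 = (a + b + ?s) * (a + b - ?s)"
      by (simp add: power2_eq_square algebra_simps)
    also have "\<dots> \<le> (2 * (a + b)) * e"
      using s e ab by (intro mult_mono) auto
    finally show ?thesis .
  qed
  then have "a * b * ((a + b)\<^sup>2 - (norm (z + w))\<^sup>2) \<le> a * b * (2 * (a + b) * e)"
    using ab by (intro mult_left_mono) auto
  finally show ?thesis
    by (simp add: algebra_simps)
qed

section \<open>The two implications between parallelism and orthogonality\<close>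

context nontrivial_normed_space
begin

context
  fixes T S :: "'a \<Rightarrow> 'a" and a b :: real
  assumes T: "T \<in> bounded_operators smul" and S: "S \<in> bounded_operators smul"
    and a: "a = numerical_radius smul T" and b: "b = numerical_radius smul S"
begin

lemma orthogonal_of_parallel:
  assumes \<mu>: "norm \<mu> = 1" and par: "numerical_radius smul (\<lambda>x. T x + smul \<mu> (S x)) = a + b"
  shows "numerical_radius_orthogonal smul T
    (\<lambda>x. smul (of_real b) (T x) + smul (- \<mu> * of_real a) (S x))"
  unfolding numerical_radius_orthogonal_def
proof
  fix \<alpha>
  let ?R = "\<lambda>x. smul (of_real b) (T x) + smul (- \<mu> * of_real a) (S x)"
  let ?U = "\<lambda>x. T x + smul \<alpha> (?R x)"
  have U: "?U \<in> bounded_operators smul"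
    using T S by (intro bounded_operators_add bounded_operators_smul)
  \<comment> \<open>The supremum need not be attained, so a pair within \<open>e\<close> of it is
    used: \<open>a - e\<close> bounds \<open>norm (f (T x))\<close> from below and the root bounds
    the cross difference \<open>?d\<close> from above.\<close>
  let ?h = "\<lambda>e. a - e - norm \<alpha> * sqrt (2 * a * b * (a + b) * e)"
  have "?h e \<le> numerical_radius smul ?U" if "0 < e" for e
  proof -
    have "\<exists>x f. norm x = 1 \<and> f \<in> support_functionals smul x \<and> a + b - e \<le> norm (f (T x + smul \<mu> (S x)))"
    proof (rule ccontr)
      assume "\<not> ?thesis"
      then have "numerical_radius smul (\<lambda>x. T x + smul \<mu> (S x)) \<le> a + b - e"
        by (intro numerical_radius_least) (meson linear order.trans)
      with par that show False by simp
    qed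
    then obtain x f where x: "norm x = 1" and f: "f \<in> support_functionals smul x"
      and "a + b - e \<le> norm (f (T x + smul \<mu> (S x)))" by blast
    then have zw: "a + b - e \<le> norm (f (T x) + \<mu> * f (S x))"
      by (simp add: support_functional_add[OF f] support_functional_smul[OF f])
    have z: "norm (f (T x)) \<le> a"
      using numerical_radius_upper[OF T x f] by (simp add: a)
    have w: "norm (\<mu> * f (S x)) \<le> b"
      using numerical_radius_upper[OF S x f] by (simp add: b norm_mult \<mu>)
    let ?d = "of_real b * f (T x) - of_real a * (\<mu> * f (S x))"
    have d: "norm ?d \<le> sqrt (2 * a * b * (a + b) * e)"
      by (rule real_le_rsqrt) (rule norm_cross_difference_le[OF z w zw])
    \<comment> \<open>The coefficients of \<open>?R\<close> make \<open>f (?R x)\<close> equal to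
      the small quantity \<open>?d\<close>.\<close>
    have fU: "f (?U x) = f (T x) + \<alpha> * ?d"
      by (simp add: support_functional_add[OF f] support_functional_smul[OF f] algebra_simps
          flip: scale_minus_left)
    \<comment> \<open>The summand with \<open>S\<close> contributes at most \<open>b\<close> to the
      total \<open>a + b - e\<close>.\<close>
    have "a - e \<le> norm (f (T x))"
      using zw w norm_triangle_ineq[of "f (T x)" "\<mu> * f (S x)"] by simp
    moreover have "norm (\<alpha> * ?d) \<le> norm \<alpha> * sqrt (2 * a * b * (a + b) * e)"
      using d by (simp add: norm_mult mult_left_mono)
    moreover have "norm (f (T x)) \<le> norm (f (?U x)) + norm (\<alpha> * ?d)"
      unfolding fU using norm_triangle_ineq4[of "f (T x) + \<alpha> * ?d" "\<alpha> * ?d"] by simp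
    ultimately show ?thesis
      using numerical_radius_upper[OF U x f] by simp
  qed
  \<comment> \<open>As \<open>e\<close> tends to 0 from the right, \<open>?h e\<close> tends to
    \<open>a\<close>, while the right side does not depend on \<open>e\<close>.\<close>
  then have "\<forall>\<^sub>F e in at_right 0. ?h e \<le> numerical_radius smul ?U"
    by (auto simp: eventually_at_filter)
  moreover have "(?h \<longlongrightarrow> a - 0 - norm \<alpha> * sqrt (2 * a * b * (a + b) * 0)) (at_right 0)"
    by (intro tendsto_intros)
  ultimately have "a \<le> numerical_radius smul ?U"
    using tendsto_upperbound[of ?h a "at_right 0"] by simp
  then show "numerical_radius smul T \<le> numerical_radius smul ?U"
    by (simp add: a)
qed

lemma parallel_of_orthogonal:
  assumes \<mu>: "norm \<mu> = 1"
    and orth: "numerical_radius_orthogonal smul T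
      (\<lambda>x. smul (of_real b) (T x) + smul (\<mu> * of_real a) (S x))"
  shows "numerical_radius smul (\<lambda>x. T x + smul (- \<mu>) (S x)) = a + b"
proof -
  let ?V = "\<lambda>x. T x + smul (- \<mu>) (S x)"
  have V: "?V \<in> bounded_operators smul"
    using T S by (intro bounded_operators_add bounded_operators_smul)
  have muS: "(\<lambda>x. smul (- \<mu>) (S x)) \<in> bounded_operators smul"
      "numerical_radius smul (\<lambda>x. smul (- \<mu>) (S x)) = b"
    using S \<mu> by (simp_all add: bounded_operators_smul numerical_radius_smul b
      del: scale_minus_left)
  have ab: "0 \<le> a" "0 \<le> b"
    using T S by (simp_all add: a b numerical_radius_nonneg)
  have "a + b \<le> numerical_radius smul ?V"
  proof (cases "a = 0")
    \<comment> \<open>Orthogonality says nothing when \<open>a = 0\<close>. Instead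
      \<open>- \<mu> S\<close> is \<open>?V - T\<close>, so the triangle inequality gives
      \<open>b \<le> numerical_radius smul ?V\<close>.\<close>
    case True
    have "(\<lambda>x. smul (- 1) (T x)) \<in> bounded_operators smul"
        "numerical_radius smul (\<lambda>x. smul (- 1) (T x)) = a"
      using T by (simp_all add: bounded_operators_smul numerical_radius_smul a
        del: scale_minus_left)
    then show ?thesis
      using numerical_radius_triangle[OF V, of "\<lambda>x. smul (- 1) (T x)"] muS(2) True by simp
  next
    case False
    \<comment> \<open>For this \<open>\<alpha>\<close> the coefficients of \<open>T\<close> and \<open>- \<mu> S\<close> in
      \<open>T + \<alpha> (v(S) T + \<mu> v(T) S)\<close> coincide.\<close>
    define \<alpha> where "\<alpha> = - (1 / (a + b))"
    let ?c = "of_real (a / (a + b)) :: 'k"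
    have c: "1 + of_real \<alpha> * of_real b = ?c" "of_real \<alpha> * (\<mu> * of_real a) = ?c * (- \<mu>)"
    proof -
      have "1 + \<alpha> * b = a / (a + b)" "\<alpha> * a = - (a / (a + b))"
        using False ab by (simp_all add: \<alpha>_def field_simps)
      then show "1 + of_real \<alpha> * of_real b = ?c" "of_real \<alpha> * (\<mu> * of_real a) = ?c * (- \<mu>)"
        by (metis of_real_1 of_real_add of_real_mult,
            metis (no_types) of_real_mult of_real_minus mult.left_commute mult.commute
              mult_minus_left mult_minus_right)
    qed
    have "T x + smul (of_real \<alpha>) (smul (of_real b) (T x) + smul (\<mu> * of_real a) (S x)) = smul ?c (?V x)"
      for x
    proof -
      have "T x + smul (of_real \<alpha>) (smul (of_real b) (T x) + smul (\<mu> * of_real a) (S x)) =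
          smul (1 + of_real \<alpha> * of_real b) (T x) + smul (of_real \<alpha> * (\<mu> * of_real a)) (S x)"
        by (simp add: scale_right_distrib scale_left_distrib)
      also have "\<dots> = smul ?c (?V x)"
        unfolding c by (simp only: scale_right_distrib scale_scale)
      finally show ?thesis .
    qed
    then have "a \<le> numerical_radius smul (\<lambda>x. smul ?c (?V x))"
      using orth[unfolded numerical_radius_orthogonal_def, rule_format, of "of_real \<alpha>"]
      by (simp add: a)
    also have "\<dots> = a / (a + b) * numerical_radius smul ?V"
      using numerical_radius_smul[OF V, of ?c] ab by (simp del: of_real_divide of_real_add)
    \<comment> \<open>Here \<open>a > 0\<close>, so this factor can be cancelled.\<close>
    finally have "a * (a + b) \<le> a * numerical_radius smul ?V"
      using False ab by (simp add: pos_le_divide_eq)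
    then show ?thesis
      using False ab by (simp only: mult_le_cancel_left)
  qed
  moreover have "numerical_radius smul ?V \<le> a + b"
    using numerical_radius_triangle[OF T muS(1)] muS(2) by (simp add: a)
  ultimately show ?thesis by simp
qed

end

end

section \<open>Dimension and the final equivalence\<close>

text \<open>In the zero space a nonempty basis would contain 0, contradicting independence.\<close>

lemma (in vector_space) nonzero_vector_exists:
  assumes "dim_at_least scale 1"
  shows "\<exists>x :: 'b. x \<noteq> 0"
proof (rule ccontr)
  assume "\<not> ?thesis"
  then have zero: "x = 0" for x :: 'b by blast
  obtain B where B: "independent B" and inf: "infinite B \<or> 1 \<le> card B"
    using assms by (auto simp: dim_at_least_def)
  have "B \<noteq> {}" using inf by auto
  then have "0 \<in> B" using zero by (metis all_not_in_conv)
  with B dependent_zero show False by blast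
qed

theorem theorem25:
  fixes smul :: "'k::real_or_complex \<Rightarrow> 'a::real_normed_vector \<Rightarrow> 'a"
    and T S :: "'a \<Rightarrow> 'a"
  assumes "normed_space_over smul"
    and "dim_at_least smul 2"
    and "T \<in> bounded_operators smul"
    and "S \<in> bounded_operators smul"
  shows "numerical_radius_parallel smul T S \<longleftrightarrow>
    (\<exists>\<mu>. norm \<mu> = 1 \<and>
       numerical_radius_orthogonal smul T
         (\<lambda>x. smul (of_real (numerical_radius smul S)) (T x) +
              smul (\<mu> * of_real (numerical_radius smul T)) (S x)))"
proof -
  interpret normed_space_over smul by fact
  have "dim_at_least smul 1"
    using assms(2) unfolding dim_at_least_def by fastforce
  then interpret nontrivial_normed_space smul
    by unfold_locales (rule nonzero_vector_exists)
  note orthogonal = orthogonal_of_parallel[OF assms(3,4) refl refl]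
  note parallel = parallel_of_orthogonal[OF assms(3,4) refl refl]
  show ?thesis
    unfolding numerical_radius_parallel_def
  proof (intro iffI; elim exE conjE)
    fix \<mu> :: 'k
    assume "norm \<mu> = 1" and "numerical_radius smul (\<lambda>x. T x + smul \<mu> (S x)) =
      numerical_radius smul T + numerical_radius smul S"
    \<comment> \<open>The two conditions correspond under \<open>\<mu>\<close> and
      \<open>- \<mu>\<close>, which have the same norm; the converse uses the same change of
      sign.\<close>
    then show "\<exists>\<mu>. norm \<mu> = 1 \<and> numerical_radius_orthogonal smul T
        (\<lambda>x. smul (of_real (numerical_radius smul S)) (T x) +
          smul (\<mu> * of_real (numerical_radius smul T)) (S x))"
      by (intro exI[of _ "- \<mu>"] conjI orthogonal) simp_all
  next
    fix \<mu> :: 'k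
    assume "norm \<mu> = 1" and "numerical_radius_orthogonal smul T
      (\<lambda>x. smul (of_real (numerical_radius smul S)) (T x) +
        smul (\<mu> * of_real (numerical_radius smul T)) (S x))"
    then show "\<exists>\<mu>. norm \<mu> = 1 \<and> numerical_radius smul (\<lambda>x. T x + smul \<mu> (S x)) =
        numerical_radius smul T + numerical_radius smul S"
      by (intro exI[of _ "- \<mu>"] conjI parallel) simp_all
  qed
qed

end
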